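(* Let $\nu\ge 0$ and $\beta>0$. For $\mu>0$ let $\varphi_{\nu,\mu,\beta}:[0,\infty)\to\mathbb{R}$ be the reparameterized generalized Wendland correlation function, $\varphi_{\nu,\mu,\beta}(r)=\mathcal{GW}_{\nu,\mu,\delta_{\nu,\mu,\beta}}(r)$, and let $\mathcal{M}_{\nu+1/2,\beta}$ be the Matérn correlation function with smoothness parameter $\nu+1/2$ and scale parameter $\beta$. Then $$\lim_{\mu\to\infty}\varphi_{\nu,\mu,\beta}(r)=\mathcal{M}_{\nu+1/2,\beta}(r),$$ with uniform convergence for $r\in(0,\infty)$; that is, $$\lim_{\mu\to\infty}\ \sup_{r\in(0,\infty)}\left|\varphi_{\nu,\mu,\beta}(r)-\mathcal{M}_{\nu+1/2,\beta}(r)\right|=0 .$$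
   Context: Matérn correlation function: for $\kappa>0$, $\beta>0$, $$\mathcal{M}_{\kappa,\beta}(r)=\frac{2^{1-\kappa}}{\Gamma(\kappa)}\left(\frac r\beta\right)^{\kappa}\mathcal{K}_{\kappa}\!\left(\frac r\beta\right),\qquad r>0,\qquad \mathcal M_{\kappa,\beta}(0)=1,$$ where $\Gamma$ is the gamma function and $\mathcal{K}_\kappa$ is the modified Bessel function of the second kind of order $\kappa$. Generalized Wendland correlation function with compact support parameter $b>0$: for $\nu>0$ and $\mu>0$, $$\mathcal{GW}_{\nu,\mu,b}(r)=\begin{cases}\dfrac{1}{B(2\nu,\mu+1)}\displaystyle\int_{r/b}^{1}u\left(u^2-(r/b)^2\right)^{\nu-1}(1-u)^{\mu}\,du, & 0\le r\le b,\\[2mm] 0,& r>b,\end{cases}$$ where $B$ is the beta function; and for $\nu=0$, $$\mathcal{GW}_{0,\mu,b}(r)=\begin{cases}(1-r/b)^{\mu},&0\le r\le b,\\ 0,& r>b.\end{cases}$$ Reparameterized compact support and model: for $\nu\ge0$, $\mu>0$, $\beta>0$, $$\delta_{\nu,\mu,\beta}=\beta\left(\frac{\Gamma(\mu+2\nu+1)}{\Gamma(\mu)}\right)^{\frac{1}{1+2\nu}},\qquad \varphi_{\nu,\mu,\beta}(r):=\mathcal{GW}_{\nu,\mu,\delta_{\nu,\mu,\beta}}(r),\quad r\ge 0.$$ *)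

theory Defs
  imports "HOL-Analysis.Analysis"
begin

(* Modified Bessel function of the second kind, of real order kappa and argument x > 0,
   defined by its integral representation (DLMF 10.32.9), which is valid for every real
   order and converges absolutely for x > 0. *)
definition Bessel_K :: "real \<Rightarrow> real \<Rightarrow> real" where
  "Bessel_K \<kappa> x = (LBINT t:{0..}. exp (- x * cosh t) * cosh (\<kappa> * t))"

(* The correlation functions below are meant for arguments r >= 0 only. *)

definition matern :: "real \<Rightarrow> real \<Rightarrow> real \<Rightarrow> real" where
  "matern \<kappa> \<beta> r =
     (if r = 0 then 1
      else 2 powr (1 - \<kappa>) / Gamma \<kappa> * (r / \<beta>) powr \<kappa> * Bessel_K \<kappa> (r / \<beta>))"

(* For 0 < nu < 1 the integrand is singular at u = r/b but still Lebesgue integrable. *)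
definition gen_wendland :: "real \<Rightarrow> real \<Rightarrow> real \<Rightarrow> real \<Rightarrow> real" where
  "gen_wendland \<nu> \<mu> b r =
     (if r > b then 0
      else if \<nu> = 0 then (1 - r / b) powr \<mu>
      else 1 / Beta (2 * \<nu>) (\<mu> + 1) *
        (LBINT u:{r / b..1}. u * (u\<^sup>2 - (r / b)\<^sup>2) powr (\<nu> - 1) * (1 - u) powr \<mu>))"

definition wendland_support :: "real \<Rightarrow> real \<Rightarrow> real \<Rightarrow> real" where
  "wendland_support \<nu> \<mu> \<beta> = \<beta> * (Gamma (\<mu> + 2 * \<nu> + 1) / Gamma \<mu>) powr (1 / (1 + 2 * \<nu>))"

definition reparam_wendland :: "real \<Rightarrow> real \<Rightarrow> real \<Rightarrow> real \<Rightarrow> real" where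
  "reparam_wendland \<nu> \<mu> \<beta> r = gen_wendland \<nu> \<mu> (wendland_support \<nu> \<mu> \<beta>) r"

end

theory Submission
  imports Defs
begin

text \<open>
  Put \<open>x = r / \<beta>\<close> and \<open>D = wendland_support \<nu> \<mu> \<beta> / \<beta>\<close>. For \<open>\<nu> > 0\<close> the substitution
  \<open>w = (D u)\<^sup>2 - x\<^sup>2\<close> gives
  \<open>reparam_wendland \<nu> \<mu> \<beta> r = 1 / (2 \<Gamma>(2\<nu>)) \<integral> w\<^bsup>\<nu>-1\<^esup> (D / \<mu>) (1 - s / D)\<^bsub>+\<^esub>\<^bsup>\<mu>\<^esup> dw\<close> with
  \<open>s = sqrt (w + x\<^sup>2)\<close>, the integral being over \<open>w > 0\<close>; the Matern function is the same
  integral with \<open>exp (- s)\<close> in place of \<open>(D / \<mu>) (1 - s / D)\<^bsub>+\<^esub>\<^bsup>\<mu>\<^esup>\<close>. The latter holds because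
  Matern functions are scale mixtures of Gaussians: the mixture for \<open>exp (- s)\<close>, which is the
  Matern function of order 1/2, is integrated against \<open>w\<^bsup>\<nu>-1\<^esup>\<close> with Tonelli's theorem and
  Legendre's duplication formula.

  Log-convexity of \<open>\<Gamma>\<close> gives \<open>\<mu> - 1 \<le> D \<le> \<mu> + 2\<nu> + 1\<close>, so the two integrands differ by at most
  \<open>C / \<mu>\<close> times \<open>w\<^bsup>\<nu>-1\<^esup> exp (- s / 2)\<close>. As \<open>s \<ge> sqrt w\<close>, this bound has an integrable majorant
  independent of \<open>x\<close>, and the convergence is uniform with rate \<open>1 / \<mu>\<close>.
\<close>

subsection \<open>Substitution in nonnegative integrals\<close>

text \<open>Lets all computations run in \<open>ennreal\<close>. The second equation covers infinite
  integrals too: \<open>enn2real\<close> sends \<open>top\<close> to 0, which is also the value of a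
  Bochner integral that does not exist.\<close>

lemma set_nn_integral_eq_integral:
  fixes f :: "real \<Rightarrow> real"
  assumes [measurable]: "A \<in> sets borel" "f \<in> borel_measurable borel"
    and nonneg: "\<And>x. x \<in> A \<Longrightarrow> 0 \<le> f x"
  shows "set_integrable lborel A f \<longleftrightarrow> (\<integral>\<^sup>+x\<in>A. ennreal (f x) \<partial>lborel) < \<infinity>"
    and "(LBINT x:A. f x) = enn2real (\<integral>\<^sup>+x\<in>A. ennreal (f x) \<partial>lborel)"
proof -
  have *: "(\<integral>\<^sup>+x. ennreal (indicator A x *\<^sub>R f x) \<partial>lborel) = (\<integral>\<^sup>+x\<in>A. ennreal (f x) \<partial>lborel)"
    by (intro nn_integral_cong) (auto simp: indicator_def)
  have pos: "0 \<le> indicator A x *\<^sub>R f x" for x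
    using nonneg by (auto simp: indicator_def)
  show "(LBINT x:A. f x) = enn2real (\<integral>\<^sup>+x\<in>A. ennreal (f x) \<partial>lborel)"
    unfolding set_lebesgue_integral_def *[symmetric]
    by (rule integral_eq_nn_integral) (use pos in auto)
  show "set_integrable lborel A f \<longleftrightarrow> (\<integral>\<^sup>+x\<in>A. ennreal (f x) \<partial>lborel) < \<infinity>"
    unfolding set_integrable_def integrable_iff_bounded *[symmetric]
    using pos by simp
qed

text \<open>Translates the format of the change of variables theorem, absolute integrability
  together with the value of the gauge integral, into one equation in \<open>ennreal\<close>. The
  passage from \<open>lebesgue\<close> to \<open>lborel\<close> is the completion of the measure,
  harmless for Borel functions.\<close>

lemma absolutely_integrable_iff_set_nn_integral:
  fixes f :: "real \<Rightarrow> real"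
  assumes [measurable]: "A \<in> sets borel" "f \<in> borel_measurable borel"
    and nonneg: "\<And>x. x \<in> A \<Longrightarrow> 0 \<le> f x" and "0 \<le> b"
  shows "f absolutely_integrable_on A \<and> integral A f = b \<longleftrightarrow>
    (\<integral>\<^sup>+x\<in>A. ennreal (f x) \<partial>lborel) = ennreal b"
proof -
  let ?N = "\<integral>\<^sup>+x\<in>A. ennreal (f x) \<partial>lborel"
  have iff: "f absolutely_integrable_on A \<longleftrightarrow> set_integrable lborel A f"
    unfolding set_integrable_def by (intro integrable_completion) auto
  have eq: "integral A f = enn2real ?N" if "f absolutely_integrable_on A"
  proof -
    have "integral A f = (LINT x:A|lebesgue. f x)"
      using set_lebesgue_integral_eq_integral(2)[OF that] by simp
    also have "\<dots> = (LBINT x:A. f x)"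
      unfolding set_lebesgue_integral_def by (intro integral_completion) auto
    finally show ?thesis
      using set_nn_integral_eq_integral(2)[OF assms(1-3)] by simp
  qed
  have fin: "f absolutely_integrable_on A \<longleftrightarrow> ?N < \<infinity>"
    using iff set_nn_integral_eq_integral(1)[OF assms(1-3)] by simp
  show ?thesis
  proof
    assume L: "f absolutely_integrable_on A \<and> integral A f = b"
    then have "?N < top" "enn2real ?N = b" using fin eq by auto
    then show "?N = ennreal b" using ennreal_enn2real by metis
  next
    assume R: "?N = ennreal b"
    then have "f absolutely_integrable_on A" using fin by simp
    then show "f absolutely_integrable_on A \<and> integral A f = b"
      using eq R \<open>0 \<le> b\<close> by simp
  qed
qed

text \<open>The change of variables theorem says that one side equals a real \<open>b\<close> iff
  the other does. So the two sides agree as soon as one is finite, and otherwise both are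
  \<open>top\<close>.\<close>

lemma set_nn_integral_substitution:
  fixes f g g' :: "real \<Rightarrow> real"
  assumes S: "S \<in> sets borel" and gS: "g ` S = T" "T \<in> sets borel"
    and der: "\<And>x. x \<in> S \<Longrightarrow> (g has_field_derivative g' x) (at x within S)"
    and inj: "inj_on g S"
    and [measurable]: "f \<in> borel_measurable borel" "g \<in> borel_measurable borel"
      "g' \<in> borel_measurable borel"
    and nonneg: "\<And>y. y \<in> T \<Longrightarrow> 0 \<le> f y"
  shows "(\<integral>\<^sup>+y\<in>T. ennreal (f y) \<partial>lborel) = (\<integral>\<^sup>+x\<in>S. ennreal (\<bar>g' x\<bar> * f (g x)) \<partial>lborel)"
    (is "?L = ?R")
proof -
  have iff: "?R = ennreal b \<longleftrightarrow> ?L = ennreal b" if "0 \<le> b" for b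
  proof -
    have "S \<in> sets lebesgue" using S by auto
    from has_absolute_integral_change_of_variables_1'[OF this der inj, of f b]
    show ?thesis
      using absolutely_integrable_iff_set_nn_integral[of S "\<lambda>x. \<bar>g' x\<bar> * f (g x)" b]
        absolutely_integrable_iff_set_nn_integral[of T f b] that nonneg S gS by auto
  qed
  consider b where "0 \<le> b" "?L = ennreal b" | b where "0 \<le> b" "?R = ennreal b" | "?L = top" "?R = top"
    by (metis ennreal_cases)
  then show ?thesis
  proof cases
    case 1
    from iff[OF 1(1), THEN iffD2, OF 1(2)] 1(2) show ?thesis by (simp only:)
  next
    case 2
    from iff[OF 2(1), THEN iffD1, OF 2(2)] 2(2) show ?thesis by (simp only:)
  next
    case 3
    then show ?thesis by (simp only:)
  qed
qed

text \<open>Euler's integral rescaled by \<open>a\<close>. The scale \<open>a = 4 * y\<close> is the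
  one that arises when a Gaussian mixture is integrated against a power; elsewhere
  \<open>a = 1\<close>.\<close>

lemma Gamma_eq_nn_integral_scaled:
  fixes s a :: real
  assumes s: "s > 0" and a: "a > 0"
  shows "(\<integral>\<^sup>+t\<in>{0<..}. ennreal (t powr (s - 1) * exp (- t / a)) \<partial>lborel) =
    ennreal (Gamma s * a powr s)"
proof -
  have 1: "(\<integral>\<^sup>+t\<in>{0<..}. ennreal (t powr (s - 1) * exp (- t)) \<partial>lborel) = ennreal (Gamma s)"
    unfolding Gamma_conv_nn_integral_real[OF s]
    by (intro nn_integral_cong) (auto simp: indicator_def exp_minus divide_simps)
  have img: "(\<lambda>t. a * t) ` {0<..} = {0<..}"
  proof (intro equalityI subsetI)
    fix y :: real assume "y \<in> {0<..}"
    then show "y \<in> (\<lambda>t. a * t) ` {0<..}"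
      using a by (intro image_eqI[of _ _ "y / a"]) auto
  qed (use a in auto)
  have "(\<integral>\<^sup>+t\<in>{0<..}. ennreal (t powr (s - 1) * exp (- t / a)) \<partial>lborel) =
     (\<integral>\<^sup>+t\<in>{0<..}. ennreal (\<bar>a\<bar> * ((a * t) powr (s - 1) * exp (- (a * t) / a))) \<partial>lborel)"
    by (rule set_nn_integral_substitution[where g = "\<lambda>t. a * t", OF _ img])
       (use a in \<open>auto intro!: derivative_eq_intros inj_onI\<close>)
  also have "\<dots> = (\<integral>\<^sup>+t. ennreal (a powr s) * (ennreal (t powr (s - 1) * exp (- t)) * indicator {0<..} t) \<partial>lborel)"
  proof (intro nn_integral_cong)
    fix t :: real
    have "a * a powr (s - 1) = a powr s"
      using a by (simp add: powr_mult_base)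
    then show "ennreal (\<bar>a\<bar> * ((a * t) powr (s - 1) * exp (- (a * t) / a))) * indicator {0<..} t =
        ennreal (a powr s) * (ennreal (t powr (s - 1) * exp (- t)) * indicator {0<..} t)"
      using a by (auto simp: indicator_def powr_mult ennreal_mult'[symmetric] mult.assoc[symmetric])
  qed
  also have "\<dots> = ennreal (Gamma s * a powr s)"
    by (subst nn_integral_cmult, simp, subst 1) (use s in \<open>auto simp: ennreal_mult'[symmetric] mult.commute\<close>)
  finally show ?thesis .
qed

subsection \<open>Matern functions as Gaussian mixtures\<close>

text \<open>For \<kappa> > 0 this is \<open>Gamma \<kappa>\<close> times the mean of the Gaussian
  profile exp (- x^2 / (4 y)) over a Gamma-distributed y with shape \<kappa>. Values in
  \<open>ennreal\<close> let Tonelli's theorem apply before finiteness is known.\<close>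

definition gauss_mixture :: "real \<Rightarrow> real \<Rightarrow> ennreal" where
  "gauss_mixture \<kappa> x = (\<integral>\<^sup>+y\<in>{0<..}. ennreal (y powr (\<kappa> - 1) * exp (- y - x\<^sup>2 / (4 * y))) \<partial>lborel)"

lemma borel_measurable_cosh [measurable]: "(cosh :: real \<Rightarrow> real) \<in> borel_measurable borel"
  and borel_measurable_sinh [measurable]: "(sinh :: real \<Rightarrow> real) \<in> borel_measurable borel"
  by (auto intro!: borel_measurable_continuous_onI continuous_intros)

text \<open>Splitting \<open>cosh (\<kappa> * t)\<close> into exponentials and reflecting one of
  them unfolds the integral to the whole line. Then y = (x / 2) exp t is substituted, for which y +
  x^2 / (4 y) = x cosh t.\<close>

lemma nn_integral_cosh_eq_gauss_mixture:
  assumes x: "x > 0"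
  shows "(\<integral>\<^sup>+t\<in>{0..}. ennreal (exp (- x * cosh t) * cosh (\<kappa> * t)) \<partial>lborel) =
    ennreal ((x / 2) powr (- \<kappa>) / 2) * gauss_mixture \<kappa> x"
proof -
  let ?F = "\<lambda>\<kappa> t. exp (- x * cosh t + \<kappa> * t) / 2"
  \<comment> \<open>The null point 0 is dropped before reflecting, so that the image
    \<open>{..<0}\<close> is the exact complement of \<open>{0..}\<close>.\<close>
  have reflect: "(\<integral>\<^sup>+t\<in>{0..}. ennreal (?F (- \<kappa>) t) \<partial>lborel) =
      (\<integral>\<^sup>+t\<in>{..<0}. ennreal (?F \<kappa> t) \<partial>lborel)"
  proof -
    have "(\<integral>\<^sup>+t\<in>{0..}. ennreal (?F (- \<kappa>) t) \<partial>lborel) =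
        (\<integral>\<^sup>+t\<in>{0<..}. ennreal (?F (- \<kappa>) t) \<partial>lborel)"
      by (intro nn_integral_cong_AE eventually_mono[OF AE_lborel_singleton[of 0]])
         (auto simp: indicator_def)
    also have "\<dots> = (\<integral>\<^sup>+t\<in>{..<0}. ennreal (?F \<kappa> t) \<partial>lborel)"
      by (subst nn_integral_real_affine[where c = "-1" and t = 0])
         (auto intro!: nn_integral_cong simp: indicator_def)
    finally show ?thesis .
  qed
  have "(\<integral>\<^sup>+t\<in>{0..}. ennreal (exp (- x * cosh t) * cosh (\<kappa> * t)) \<partial>lborel) =
      (\<integral>\<^sup>+t. ennreal (?F \<kappa> t) * indicator {0..} t + ennreal (?F (- \<kappa>) t) * indicator {0..} t \<partial>lborel)"
  proof (intro nn_integral_cong)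
    fix t :: real
    have "exp (- x * cosh t) * cosh (\<kappa> * t) = ?F \<kappa> t + ?F (- \<kappa>) t"
      unfolding exp_add cosh_field_def by (simp add: field_simps)
    then show "ennreal (exp (- x * cosh t) * cosh (\<kappa> * t)) * indicator {0..} t =
        ennreal (?F \<kappa> t) * indicator {0..} t + ennreal (?F (- \<kappa>) t) * indicator {0..} t"
      by (cases "t \<ge> 0") (simp_all add: ennreal_plus[symmetric] del: ennreal_plus)
  qed
  also have "\<dots> = (\<integral>\<^sup>+t\<in>{0..}. ennreal (?F \<kappa> t) \<partial>lborel) + (\<integral>\<^sup>+t\<in>{..<0}. ennreal (?F \<kappa> t) \<partial>lborel)"
    unfolding reflect[symmetric] by (rule nn_integral_add) auto
  also have "\<dots> = (\<integral>\<^sup>+t. ennreal (?F \<kappa> t) \<partial>lborel)"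
    by (subst nn_integral_add[symmetric]) (auto intro!: nn_integral_cong simp: indicator_def)
  also have "\<dots> = (\<integral>\<^sup>+t. ennreal ((x / 2) powr (- \<kappa>) / 2) *
      (ennreal (\<bar>(x / 2) * exp t\<bar> * (((x / 2) * exp t) powr (\<kappa> - 1) *
        exp (- ((x / 2) * exp t) - x\<^sup>2 / (4 * ((x / 2) * exp t))))) * indicator UNIV t) \<partial>lborel)"
  proof (intro nn_integral_cong)
    fix t :: real
    let ?y = "(x / 2) * exp t"
    have y: "?y > 0" using x by simp
    have "\<bar>?y\<bar> * ?y powr (\<kappa> - 1) = ?y powr (1 + (\<kappa> - 1))"
      unfolding abs_of_pos[OF y] by (rule powr_mult_base[OF less_imp_le[OF y]])
    also have "\<dots> = ?y powr \<kappa>" by simp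
    also have "\<dots> = (x / 2) powr \<kappa> * exp (\<kappa> * t)"
      by (subst powr_mult) (use x in \<open>auto simp: exp_powr_real mult.commute\<close>)
    finally have 1: "\<bar>?y\<bar> * ?y powr (\<kappa> - 1) = (x / 2) powr \<kappa> * exp (\<kappa> * t)" .
    have 2: "- ?y - x\<^sup>2 / (4 * ?y) = - x * cosh t"
    proof -
      have "x\<^sup>2 / (4 * ?y) = (x / 2) * inverse (exp t)"
        using x by (simp add: divide_simps power2_eq_square)
      then show ?thesis
        unfolding cosh_field_def exp_minus by (simp add: distrib_left distrib_right)
    qed
    have "(x / 2) powr (- \<kappa>) / 2 * (\<bar>?y\<bar> * (?y powr (\<kappa> - 1) * exp (- ?y - x\<^sup>2 / (4 * ?y)))) = 
        (x / 2) powr (- \<kappa>) / 2 * ((\<bar>?y\<bar> * ?y powr (\<kappa> - 1)) * exp (- ?y - x\<^sup>2 / (4 * ?y)))"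
      by (simp only: mult.assoc)
    also have "\<dots> = ?F \<kappa> t"
      unfolding 1 2 exp_add using x by (simp add: powr_minus)
    finally have eq: "(x / 2) powr (- \<kappa>) / 2 *
        (\<bar>?y\<bar> * (?y powr (\<kappa> - 1) * exp (- ?y - x\<^sup>2 / (4 * ?y)))) = ?F \<kappa> t" .
    show "ennreal (?F \<kappa> t) = ennreal ((x / 2) powr (- \<kappa>) / 2) *
      (ennreal (\<bar>?y\<bar> * (?y powr (\<kappa> - 1) * exp (- ?y - x\<^sup>2 / (4 * ?y)))) * indicator UNIV t)"
      unfolding eq[symmetric] by (subst ennreal_mult') simp_all
  qed
  also have "\<dots> = ennreal ((x / 2) powr (- \<kappa>) / 2) * gauss_mixture \<kappa> x"
  proof -
    have img: "(\<lambda>t. (x / 2) * exp t) ` UNIV = {0<..}"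
    proof (intro equalityI subsetI)
      fix y :: real assume "y \<in> {0<..}"
      then have "y = (x / 2) * exp (ln (2 * y / x))"
        using x by simp
      then show "y \<in> (\<lambda>t. (x / 2) * exp t) ` UNIV"
        by (rule image_eqI) simp
    qed (use x in auto)
    have "gauss_mixture \<kappa> x = (\<integral>\<^sup>+t\<in>UNIV. ennreal (\<bar>(x / 2) * exp t\<bar> * (((x / 2) * exp t) powr (\<kappa> - 1) *
        exp (- ((x / 2) * exp t) - x\<^sup>2 / (4 * ((x / 2) * exp t))))) \<partial>lborel)"
      unfolding gauss_mixture_def
      by (rule set_nn_integral_substitution[where g = "\<lambda>t. (x / 2) * exp t", OF _ img])
         (use x in \<open>auto intro!: derivative_eq_intros simp: inj_on_def\<close>)
    then show ?thesis
      by (subst nn_integral_cmult) auto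
  qed
  finally show ?thesis .
qed

lemma nn_integral_cosh_half:
  assumes x: "x > (0::real)"
  shows "(\<integral>\<^sup>+t\<in>{0..}. ennreal (exp (- x * cosh t) * cosh (1 / 2 * t)) \<partial>lborel) =
    ennreal (exp (- x) * sqrt pi / sqrt (2 * x))"
proof -
  \<comment> \<open>Since \<open>cosh t = 1 + 2 (sinh (t / 2))\<^sup>2\<close>, this substitution turns the integral into \<open>\<Gamma>(1/2)\<close>.\<close>
  let ?g = "\<lambda>t. 2 * x * (sinh (t / 2))\<^sup>2"
  let ?g' = "\<lambda>t. 2 * x * (sinh (t / 2) * cosh (t / 2))"
  let ?f = "\<lambda>y::real. exp (- x) / sqrt (2 * x) * (y powr (1 / 2 - 1) * exp (- y / 1))"
  have img: "?g ` {0<..} = {0<..}"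
  proof (intro equalityI subsetI)
    fix y :: real assume "y \<in> {0<..}"
    then show "y \<in> ?g ` {0<..}"
      using x by (intro image_eqI[of _ _ "2 * arsinh (sqrt (y / (2 * x)))"]) auto
  qed (use x in auto)
  have inj: "inj_on ?g {0<..}"
    using x by (intro inj_onI) (auto simp: power2_eq_iff_nonneg)
  have "(\<integral>\<^sup>+t\<in>{0..}. ennreal (exp (- x * cosh t) * cosh (1 / 2 * t)) \<partial>lborel) =
      (\<integral>\<^sup>+t\<in>{0<..}. ennreal (exp (- x * cosh t) * cosh (1 / 2 * t)) \<partial>lborel)"
    by (intro nn_integral_cong_AE eventually_mono[OF AE_lborel_singleton[of 0]])
       (auto simp: indicator_def)
  also have "\<dots> = (\<integral>\<^sup>+t\<in>{0<..}. ennreal (\<bar>?g' t\<bar> * ?f (?g t)) \<partial>lborel)"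
  proof (intro nn_integral_cong)
    fix t :: real
    show "ennreal (exp (- x * cosh t) * cosh (1 / 2 * t)) * indicator {0<..} t =
      ennreal (\<bar>?g' t\<bar> * ?f (?g t)) * indicator {0<..} t"
    proof (cases "t > 0")
      case True
      define s c where "s = sinh (t / 2)" and "c = cosh (t / 2)"
      have s: "s > 0" and c: "c > 0" using True by (auto simp: s_def c_def)
      have ch: "cosh t = 1 + 2 * s\<^sup>2"
        using cosh_double_cosh[of "t / 2"] cosh_square_eq[of "t / 2"] by (simp add: s_def)
      define q where "q = sqrt (2 * x)"
      have q: "q > 0" "2 * x = q * q" using x by (auto simp: q_def)
      have "(2 * x * s\<^sup>2) powr (1 / 2 - 1) = inverse (sqrt (2 * x * s\<^sup>2))"
        using x s by (simp add: powr_minus powr_half_sqrt)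
      also have "sqrt (2 * x * s\<^sup>2) = q * s"
        using s by (simp add: real_sqrt_mult q_def)
      finally have p: "(2 * x * s\<^sup>2) powr (1 / 2 - 1) = inverse (q * s)" .
      have "\<bar>2 * x * (s * c)\<bar> * ?f (2 * x * s\<^sup>2) =
          (q * q * (s * c)) * (exp (- x) / q * (inverse (q * s) * exp (- (2 * x * s\<^sup>2))))"
        unfolding p q_def[symmetric] using q s c x by simp
      also have "\<dots> = (exp (- x) * exp (- (2 * x * s\<^sup>2))) * c"
        using q s by (simp add: field_simps)
      also have "\<dots> = exp (- x * cosh t) * c"
        unfolding ch exp_add[symmetric] by (simp add: algebra_simps)
      finally show ?thesis by (simp add: s_def c_def)
    qed auto
  qed
  also have "\<dots> = (\<integral>\<^sup>+y\<in>{0<..}. ennreal (?f y) \<partial>lborel)"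
    by (rule set_nn_integral_substitution[OF _ img _ _ inj, symmetric])
       (use x in \<open>auto intro!: derivative_eq_intros simp: field_simps\<close>)
  also have "\<dots> = (\<integral>\<^sup>+y. ennreal (exp (- x) / sqrt (2 * x)) *
      (ennreal (y powr (1 / 2 - 1) * exp (- y / 1)) * indicator {0<..} y) \<partial>lborel)"
    using x by (intro nn_integral_cong) (auto simp: indicator_def ennreal_mult'[symmetric])
  also have "\<dots> = ennreal (exp (- x) / sqrt (2 * x)) * ennreal (Gamma (1 / 2) * 1 powr (1 / 2))"
    by (subst nn_integral_cmult, simp, subst Gamma_eq_nn_integral_scaled) auto
  also have "\<dots> = ennreal (exp (- x) * sqrt pi / sqrt (2 * x))"
    using x by (subst ennreal_mult'[symmetric]) (auto simp: Gamma_one_half_real)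
  finally show ?thesis .
qed

text \<open>Two evaluations of the cosh integral at order 1/2 are compared: the general one by the
  mixture and the explicit one. The common factor \<open>1 / c\<close> is then cancelled.\<close>

lemma gauss_mixture_half:
  assumes x: "x > 0"
  shows "gauss_mixture (1 / 2) x = ennreal (sqrt pi * exp (- x))"
proof -
  define c where "c = (x / 2) powr (1 / 2) * 2"
  have c: "c > 0" using x by (simp add: c_def)
  have inv: "(x / 2) powr (- (1 / 2)) / 2 = 1 / c"
    by (simp add: c_def powr_minus field_simps)
  have "c = sqrt (2 * x)"
  proof -
    have "c = sqrt (x / 2) * sqrt 4" using x by (simp add: c_def powr_half_sqrt)
    also have "\<dots> = sqrt (2 * x)" by (simp only: real_sqrt_mult[symmetric]) simp
    finally show ?thesis .
  qed
  then have "ennreal (1 / c) * gauss_mixture (1 / 2) x = ennreal (exp (- x) * sqrt pi / c)"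
    using nn_integral_cosh_eq_gauss_mixture[OF x, of "1 / 2"] nn_integral_cosh_half[OF x]
    unfolding inv by simp
  then have "ennreal c * ennreal (1 / c) * gauss_mixture (1 / 2) x =
      ennreal c * ennreal (exp (- x) * sqrt pi / c)" by (simp only: mult.assoc)
  also have "ennreal c * ennreal (1 / c) = 1"
    using c by (subst ennreal_mult'[symmetric]) auto
  also have "ennreal c * ennreal (exp (- x) * sqrt pi / c) = ennreal (sqrt pi * exp (- x))"
    using c by (subst ennreal_mult'[symmetric]) (auto simp: mult.commute)
  finally show ?thesis by simp
qed

text \<open>The power of \<open>x / 2\<close> produced by the substitution in the Bessel integral is
  exactly inverse to the prefactor 2^(1 - \<kappa>) x^\<kappa>, so only
  \<open>Gamma \<kappa>\<close> remains.\<close>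

lemma matern_eq_gauss_mixture:
  assumes "\<kappa> > 0" "\<beta> > 0" "r > 0"
  shows "matern \<kappa> \<beta> r = enn2real (gauss_mixture \<kappa> (r / \<beta>)) / Gamma \<kappa>"
proof -
  define x where "x = r / \<beta>"
  have x: "x > 0" using assms by (simp add: x_def)
  have "Bessel_K \<kappa> x = enn2real (\<integral>\<^sup>+t\<in>{0..}. ennreal (exp (- x * cosh t) * cosh (\<kappa> * t)) \<partial>lborel)"
    unfolding Bessel_K_def by (rule set_nn_integral_eq_integral(2)) auto
  also have "\<dots> = (x / 2) powr (- \<kappa>) / 2 * enn2real (gauss_mixture \<kappa> x)"
    unfolding nn_integral_cosh_eq_gauss_mixture[OF x] enn2real_mult by simp
  finally have K: "Bessel_K \<kappa> x = (x / 2) powr (- \<kappa>) / 2 * enn2real (gauss_mixture \<kappa> x)" .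
  have "2 powr (1 - \<kappa>) * x powr \<kappa> * ((x / 2) powr (- \<kappa>) / 2) = 1"
    using x by (simp add: powr_divide powr_minus powr_diff field_simps)
  then have "2 powr (1 - \<kappa>) * x powr \<kappa> * ((x / 2) powr (- \<kappa>) / 2) *
      enn2real (gauss_mixture \<kappa> x) / Gamma \<kappa> = enn2real (gauss_mixture \<kappa> x) / Gamma \<kappa>"
    by simp
  then show ?thesis
    using assms unfolding matern_def x_def[symmetric] K by (simp add: mult_ac)
qed

lemma Gamma_legendre_duplication_real:
  fixes z :: real
  assumes "z > 0"
  shows "Gamma z * Gamma (z + 1 / 2) = 2 powr (1 - 2 * z) * sqrt pi * Gamma (2 * z)"
proof -
  have "complex_of_real z \<notin> \<int>\<^sub>\<le>\<^sub>0" "complex_of_real z + 1 / 2 \<notin> \<int>\<^sub>\<le>\<^sub>0"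
    using assms by (auto elim!: nonpos_Ints_cases simp: complex_eq_iff)
  from Gamma_legendre_duplication[OF this]
  have "complex_of_real (Gamma z * Gamma (z + 1 / 2)) =
      complex_of_real (2 powr (1 - 2 * z) * sqrt pi * Gamma (2 * z))"
    by (simp add: Gamma_complex_of_real[symmetric] powr_def exp_of_real[symmetric])
  then show ?thesis by (simp only: of_real_eq_iff)
qed

text \<open>Write exp (- s) as the mixture of order 1/2 at s = sqrt (w + x^2). There s enters only
  through s^2, hence w appears linearly in the exponent. After Tonelli the inner integral over w is
  Euler's integral with scale 4 y; its value \<open>Gamma \<nu> * (4 * y) powr \<nu>\<close> raises
  the order from 1/2 to \<nu> + 1/2.\<close>

lemma nn_integral_exp_sqrt:
  assumes \<nu>: "\<nu> > 0" and x: "x > 0"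
  shows "(\<integral>\<^sup>+w\<in>{0<..}. ennreal (w powr (\<nu> - 1) * exp (- sqrt (w + x\<^sup>2))) \<partial>lborel) =
    ennreal (Gamma \<nu> * 4 powr \<nu> / sqrt pi) * gauss_mixture (\<nu> + 1 / 2) x"
proof -
  let ?h = "\<lambda>w y. w powr (\<nu> - 1) * y powr (1 / 2 - 1) * exp (- y - (w + x\<^sup>2) / (4 * y)) / sqrt pi"
  have "(\<integral>\<^sup>+w\<in>{0<..}. ennreal (w powr (\<nu> - 1) * exp (- sqrt (w + x\<^sup>2))) \<partial>lborel) =
      (\<integral>\<^sup>+w. \<integral>\<^sup>+y. ennreal (?h w y) * indicator {0<..} y * indicator {0<..} w \<partial>lborel \<partial>lborel)"
  proof (intro nn_integral_cong)
    fix w :: real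
    show "ennreal (w powr (\<nu> - 1) * exp (- sqrt (w + x\<^sup>2))) * indicator {0<..} w =
      (\<integral>\<^sup>+y. ennreal (?h w y) * indicator {0<..} y * indicator {0<..} w \<partial>lborel)"
    proof (cases "w > 0")
      case True
      define s where "s = sqrt (w + x\<^sup>2)"
      have s: "s > 0" "s\<^sup>2 = w + x\<^sup>2" using True x by (auto simp: s_def intro: add_pos_pos)
      have "ennreal (w powr (\<nu> - 1) * exp (- s)) =
          ennreal (w powr (\<nu> - 1) / sqrt pi) * gauss_mixture (1 / 2) s"
        unfolding gauss_mixture_half[OF s(1)] by (subst ennreal_mult'[symmetric]) auto
      also have "\<dots> = (\<integral>\<^sup>+y. ennreal (w powr (\<nu> - 1) / sqrt pi) * (ennreal (y powr (1 / 2 - 1) *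
          exp (- y - s\<^sup>2 / (4 * y))) * indicator {0<..} y) \<partial>lborel)"
        unfolding gauss_mixture_def by (subst nn_integral_cmult) auto
      also have "\<dots> = (\<integral>\<^sup>+y. ennreal (?h w y) * indicator {0<..} y * indicator {0<..} w \<partial>lborel)"
        using True unfolding s(2)
        by (intro nn_integral_cong) (auto simp: indicator_def ennreal_mult'[symmetric])
      finally show ?thesis using True by (simp add: s_def)
    qed auto
  qed
  also have "\<dots> = (\<integral>\<^sup>+y. \<integral>\<^sup>+w. ennreal (?h w y) * indicator {0<..} y * indicator {0<..} w \<partial>lborel \<partial>lborel)"
    by (rule lborel_pair.Fubini') (auto simp: case_prod_unfold)
  also have "\<dots> = (\<integral>\<^sup>+y. ennreal (Gamma \<nu> * 4 powr \<nu> / sqrt pi) *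
      (ennreal (y powr (\<nu> + 1 / 2 - 1) * exp (- y - x\<^sup>2 / (4 * y))) * indicator {0<..} y) \<partial>lborel)"
  proof (intro nn_integral_cong)
    fix y :: real
    show "(\<integral>\<^sup>+w. ennreal (?h w y) * indicator {0<..} y * indicator {0<..} w \<partial>lborel) =
      ennreal (Gamma \<nu> * 4 powr \<nu> / sqrt pi) *
      (ennreal (y powr (\<nu> + 1 / 2 - 1) * exp (- y - x\<^sup>2 / (4 * y))) * indicator {0<..} y)"
    proof (cases "y > 0")
      case True
      define c where "c = y powr (1 / 2 - 1) * exp (- y - x\<^sup>2 / (4 * y)) / sqrt pi"
      have c: "c \<ge> 0" by (simp add: c_def)
      have "?h w y = c * (w powr (\<nu> - 1) * exp (- w / (4 * y)))" for w
        unfolding c_def by (simp add: exp_add[symmetric] add_divide_distrib algebra_simps)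
      then have "(\<integral>\<^sup>+w. ennreal (?h w y) * indicator {0<..} y * indicator {0<..} w \<partial>lborel) =
          (\<integral>\<^sup>+w. ennreal c * (ennreal (w powr (\<nu> - 1) * exp (- w / (4 * y))) * indicator {0<..} w) \<partial>lborel)"
        using True c by (intro nn_integral_cong) (auto simp: indicator_def ennreal_mult'[symmetric])
      also have "\<dots> = ennreal c * ennreal (Gamma \<nu> * (4 * y) powr \<nu>)"
        by (subst nn_integral_cmult, simp, subst Gamma_eq_nn_integral_scaled) (use \<nu> True in auto)
      also have "\<dots> = ennreal (c * (Gamma \<nu> * (4 * y) powr \<nu>))"
        using c by (subst ennreal_mult'[symmetric]) auto
      also have "c * (Gamma \<nu> * (4 * y) powr \<nu>) = (Gamma \<nu> * 4 powr \<nu> / sqrt pi) *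
          (y powr (\<nu> + 1 / 2 - 1) * exp (- y - x\<^sup>2 / (4 * y)))"
      proof -
        have "y powr (\<nu> + 1 / 2 - 1) = y powr \<nu> * y powr (1 / 2 - 1)"
          by (simp add: powr_add[symmetric])
        then show ?thesis
          using True by (simp add: c_def powr_mult)
      qed
      finally show ?thesis
        using True \<nu> by (simp add: ennreal_mult'[symmetric])
    qed auto
  qed
  also have "\<dots> = ennreal (Gamma \<nu> * 4 powr \<nu> / sqrt pi) * gauss_mixture (\<nu> + 1 / 2) x"
    unfolding gauss_mixture_def by (subst nn_integral_cmult) auto
  finally show ?thesis .
qed

text \<open>The duplication formula at \<nu> turns the constant
  \<open>Gamma \<nu> * 4 powr \<nu> / sqrt pi\<close>, divided by
  \<open>2 * Gamma (2 * \<nu>)\<close>, into the Matern normalization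
  \<open>1 / Gamma (\<nu> + 1 / 2)\<close>.\<close>

lemma matern_eq_integral_exp_sqrt:
  assumes \<nu>: "\<nu> > 0" and "\<beta> > 0" "r > 0"
  defines "x \<equiv> r / \<beta>"
  shows "matern (\<nu> + 1 / 2) \<beta> r =
    (LBINT w:{0<..}. w powr (\<nu> - 1) * exp (- sqrt (w + x\<^sup>2))) / (2 * Gamma (2 * \<nu>))"
proof -
  have x: "x > 0" unfolding x_def using \<open>\<beta> > 0\<close> \<open>r > 0\<close> by (rule divide_pos_pos[rotated])
  have "(LBINT w:{0<..}. w powr (\<nu> - 1) * exp (- sqrt (w + x\<^sup>2))) =
      enn2real (\<integral>\<^sup>+w\<in>{0<..}. ennreal (w powr (\<nu> - 1) * exp (- sqrt (w + x\<^sup>2))) \<partial>lborel)"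
    by (rule set_nn_integral_eq_integral(2)) auto
  also have "\<dots> = Gamma \<nu> * 4 powr \<nu> / sqrt pi * enn2real (gauss_mixture (\<nu> + 1 / 2) x)"
    unfolding nn_integral_exp_sqrt[OF \<nu> x] enn2real_mult using \<nu> by simp
  finally have I: "(LBINT w:{0<..}. w powr (\<nu> - 1) * exp (- sqrt (w + x\<^sup>2))) =
      Gamma \<nu> * 4 powr \<nu> / sqrt pi * enn2real (gauss_mixture (\<nu> + 1 / 2) x)" .
  have G: "Gamma \<nu> > 0" "Gamma (2 * \<nu>) > 0" "Gamma (\<nu> + 1 / 2) > 0"
    using \<nu> by (auto intro!: Gamma_real_pos)
  have "(4::real) powr \<nu> = 2 powr (2 * \<nu>)"
    using powr_powr[of 2 2 \<nu>] by simp
  then have "Gamma \<nu> * Gamma (\<nu> + 1 / 2) * 4 powr \<nu> = 2 * sqrt pi * Gamma (2 * \<nu>)"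
    using Gamma_legendre_duplication_real[OF \<nu>] by (simp add: powr_diff)
  then have "Gamma \<nu> * 4 powr \<nu> / sqrt pi / (2 * Gamma (2 * \<nu>)) = 1 / Gamma (\<nu> + 1 / 2)"
    using G by (simp add: field_simps)
  then have "Gamma \<nu> * 4 powr \<nu> / sqrt pi / (2 * Gamma (2 * \<nu>)) *
      enn2real (gauss_mixture (\<nu> + 1 / 2) x) = matern (\<nu> + 1 / 2) \<beta> r"
    using matern_eq_gauss_mixture[of "\<nu> + 1 / 2" \<beta> r] assms(1-3) unfolding x_def by simp
  then show ?thesis unfolding I by simp
qed

text \<open>Serves the case \<nu> = 0, where the weight \<open>w powr (\<nu> - 1)\<close> is not
  integrable at 0 and the integral representation breaks down.\<close>

lemma matern_half:
  assumes "\<beta> > 0" "r > 0"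
  shows "matern (1 / 2) \<beta> r = exp (- (r / \<beta>))"
  using assms by (simp add: matern_eq_gauss_mixture gauss_mixture_half Gamma_one_half_real)

subsection \<open>Comparison of the Wendland and Matern functions\<close>

text \<open>The substitution is w = D^2 u^2 - x^2, that is u = sqrt (w + x^2) / D. Truncating the
  base at 0 extends the range of w to a half-line that depends on neither \<open>D\<close> nor
  \<open>x\<close>.\<close>

lemma wendland_integral_substitution:
  assumes D: "D > 0" and x: "x > 0"
  shows "(LBINT u:{x / D..1}. u * (u\<^sup>2 - (x / D)\<^sup>2) powr (\<nu> - 1) * (1 - u) powr \<mu>) =
    D powr (- 2 * \<nu>) / 2 *
      (LBINT w:{0<..}. w powr (\<nu> - 1) * max 0 (1 - sqrt (w + x\<^sup>2) / D) powr \<mu>)"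
proof -
  let ?g = "\<lambda>u. D\<^sup>2 * u\<^sup>2 - x\<^sup>2"
  let ?f = "\<lambda>w. D powr (- 2 * \<nu>) / 2 * (w powr (\<nu> - 1) * max 0 (1 - sqrt (w + x\<^sup>2) / D) powr \<mu>)"
  let ?k = "\<lambda>u. u * (u\<^sup>2 - (x / D)\<^sup>2) powr (\<nu> - 1) * (1 - u) powr \<mu>"
  have img: "?g ` {x / D<..<1} = {0<..<D\<^sup>2 - x\<^sup>2}"
  proof (intro equalityI subsetI)
    fix w assume "w \<in> ?g ` {x / D<..<1}"
    then obtain u where u: "x / D < u" "u < 1" "w = ?g u" by auto
    have "x < D * u" using u D by (simp add: field_simps)
    moreover have "D * u < D" using u D by simp
    ultimately have "x\<^sup>2 < (D * u)\<^sup>2" "(D * u)\<^sup>2 < D\<^sup>2"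
      using x by (auto intro!: power_strict_mono)
    then show "w \<in> {0<..<D\<^sup>2 - x\<^sup>2}" using u by (simp add: power_mult_distrib)
  next
    fix w assume w: "w \<in> {0<..<D\<^sup>2 - x\<^sup>2}"
    have s: "sqrt (w + x\<^sup>2) < D" "x < sqrt (w + x\<^sup>2)"
      using w D x by (auto intro!: real_less_lsqrt real_less_rsqrt)
    have "w = ?g (sqrt (w + x\<^sup>2) / D)" using w D by (simp add: power_divide)
    moreover have "sqrt (w + x\<^sup>2) / D \<in> {x / D<..<1}"
      using s D by (simp add: divide_strict_right_mono)
    ultimately show "w \<in> ?g ` {x / D<..<1}" by (rule image_eqI)
  qed
  have pos: "u > 0" if "u \<in> {x / D<..<1}" for u
    using that D x by (auto intro: less_trans[of 0 "x / D"])
  have inj: "inj_on ?g {x / D<..<1}"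
  proof (rule inj_onI)
    fix u v assume uv: "u \<in> {x / D<..<1}" "v \<in> {x / D<..<1}" and "?g u = ?g v"
    then have "u\<^sup>2 = v\<^sup>2" using D by simp
    then show "u = v" using pos[OF uv(1)] pos[OF uv(2)] by (simp add: power2_eq_iff_nonneg)
  qed
  \<comment> \<open>The integrands agree even at the endpoints: \<open>0 powr a = 0\<close> for
    every \<open>a\<close>, so one of the two powers vanishes there.\<close>
  have "(LBINT u:{x / D..1}. ?k u) = (LBINT u:{x / D<..<1}. ?k u)"
    unfolding set_lebesgue_integral_def
    by (intro Bochner_Integration.integral_cong) (auto simp: indicator_def)
  also have "\<dots> = enn2real (\<integral>\<^sup>+u\<in>{x / D<..<1}. ennreal (?k u) \<partial>lborel)"
    by (rule set_nn_integral_eq_integral(2)) (use pos in \<open>auto intro!: mult_nonneg_nonneg intro: less_imp_le\<close>)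
  also have "(\<integral>\<^sup>+u\<in>{x / D<..<1}. ennreal (?k u) \<partial>lborel) =
      (\<integral>\<^sup>+u\<in>{x / D<..<1}. ennreal (\<bar>2 * D\<^sup>2 * u\<bar> * ?f (?g u)) \<partial>lborel)"
  proof (intro nn_integral_cong)
    fix u
    show "ennreal (?k u) * indicator {x / D<..<1} u =
      ennreal (\<bar>2 * D\<^sup>2 * u\<bar> * ?f (?g u)) * indicator {x / D<..<1} u"
    proof (cases "u \<in> {x / D<..<1}")
      case True
      have u: "u > 0" "u < 1" using pos[OF True] True by auto
      have s: "sqrt (?g u + x\<^sup>2) / D = u" using D u by (simp add: real_sqrt_mult)
      have "?g u = D\<^sup>2 * (u\<^sup>2 - (x / D)\<^sup>2)" using D by (simp add: field_simps)
      then have "?g u powr (\<nu> - 1) = (D\<^sup>2) powr (\<nu> - 1) * (u\<^sup>2 - (x / D)\<^sup>2) powr (\<nu> - 1)"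
        using True x D by (simp only:) (rule powr_mult)
      also have "(D\<^sup>2) powr (\<nu> - 1) = D powr (2 * \<nu>) / D\<^sup>2"
        using D powr_powr[of D 2 "\<nu> - 1"] by (simp add: powr_diff algebra_simps)
      finally have p: "?g u powr (\<nu> - 1) = D powr (2 * \<nu>) / D\<^sup>2 * (u\<^sup>2 - (x / D)\<^sup>2) powr (\<nu> - 1)" .
      have m: "max 0 (1 - u) = 1 - u" "\<bar>2 * D\<^sup>2 * u\<bar> = 2 * D\<^sup>2 * u" using u by auto
      have "\<bar>2 * D\<^sup>2 * u\<bar> * ?f (?g u) = ?k u"
        unfolding s p m using D by (simp add: powr_minus field_simps)
      then show ?thesis by (simp only:)
    qed simp
  qed
  also have "\<dots> = (\<integral>\<^sup>+w\<in>{0<..<D\<^sup>2 - x\<^sup>2}. ennreal (?f w) \<partial>lborel)"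
    by (rule set_nn_integral_substitution[OF _ img _ _ inj, symmetric])
       (auto intro!: derivative_eq_intros)
  also have "\<dots> = (\<integral>\<^sup>+w\<in>{0<..}. ennreal (?f w) \<partial>lborel)"
  proof (intro nn_integral_cong)
    fix w
    have "?f w = 0" if "w \<ge> D\<^sup>2 - x\<^sup>2"
    proof -
      have "sqrt (w + x\<^sup>2) \<ge> D" using that by (intro real_le_rsqrt) simp
      then show ?thesis using D by (simp add: max_def)
    qed
    then show "ennreal (?f w) * indicator {0<..<D\<^sup>2 - x\<^sup>2} w = ennreal (?f w) * indicator {0<..} w"
      by (cases "w \<ge> D\<^sup>2 - x\<^sup>2") (simp_all add: indicator_def)
  qed
  also have "enn2real \<dots> = (LBINT w:{0<..}. ?f w)"
    by (rule set_nn_integral_eq_integral(2)[symmetric]) auto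
  finally show ?thesis by simp
qed

section \<open>Pointwise comparison of truncated powers with the exponential\<close>

lemma abs_exp_minus_diff_le:
  fixes p q m :: real
  assumes "m \<le> p" "m \<le> q"
  shows "\<bar>exp (- p) - exp (- q)\<bar> \<le> \<bar>p - q\<bar> * exp (- m)"
proof -
  have *: "\<bar>exp (- p) - exp (- q)\<bar> \<le> \<bar>p - q\<bar> * exp (- m)" if "m \<le> p" "p \<le> q" for p q :: real
  proof -
    have "1 - exp (- (q - p)) \<le> q - p"
      using exp_ge_add_one_self[of "p - q"] unfolding minus_diff_eq by linarith
    then have "exp (- p) * (1 - exp (- (q - p))) \<le> exp (- p) * (q - p)"
      by (intro mult_left_mono) auto
    also have "\<dots> \<le> exp (- m) * (q - p)"
      using that by (intro mult_right_mono) auto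
    also have "exp (- p) * (1 - exp (- (q - p))) = exp (- p) - exp (- q)"
      by (simp add: right_diff_distrib exp_add[symmetric])
    finally show ?thesis using that by (simp add: mult.commute abs_if)
  qed
  show ?thesis
    using *[of p q] *[of q p] assms by (cases "p \<le> q") (auto simp: abs_minus_commute)
qed

text \<open>With u = s / D and k = \<mu> / D, the power is compared with exp (- k s) through - u - 2
  u^2 \<le> ln (1 - u) \<le> - u, and exp (- k s) with exp (- s). The errors carry factors s^2 and s
  times exp (- 3 s / 4), because k \<ge> 3/4; part of this decay absorbs the factors and leaves exp
  (- s / 2).\<close>

lemma abs_powr_minus_exp_le:
  fixes \<mu> D s :: real
  assumes \<mu>: "\<mu> > 0" and D: "D \<ge> 1" and a: "3 * D \<le> 4 * \<mu>" "4 * \<mu> \<le> 5 * D" and s: "s \<ge> 0"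
  shows "\<bar>max 0 (1 - s / D) powr \<mu> - exp (- s)\<bar> \<le> (128 / D + 4 * \<bar>\<mu> / D - 1\<bar>) * exp (- (s / 2))"
proof -
  define u where "u = s / D"
  define k where "k = \<mu> / D"
  have k: "3 / 4 \<le> k" "k \<le> 5 / 4" using a D by (auto simp: k_def field_simps)
  have u: "u \<ge> 0" using s D by (simp add: u_def)
  have mu: "\<mu> * u = k * s" using D by (simp add: u_def k_def)
  \<comment> \<open>Both polynomial factors are traded for exp (s / 4); the constant 128 of the
    bound is 4 * 32.\<close>
  have q: "s\<^sup>2 \<le> 32 * exp (s / 4)"
    using exp_lower_Taylor_quadratic[of "s / 4"] s by (simp add: power_divide)
  have l: "s \<le> 4 * exp (s / 4)"
    using exp_ge_add_one_self[of "s / 4"] by linarith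
  have ks: "3 / 4 * s \<le> k * s" using k s by (intro mult_right_mono) auto
  have E: "exp (- (k * s)) \<le> exp (- (3 / 4 * s))" using ks by simp
  have Es: "exp (s / 4) * exp (- (3 / 4 * s)) = exp (- (s / 2))"
    by (simp add: exp_add[symmetric])
  have upper: "max 0 (1 - u) powr \<mu> \<le> exp (- (k * s))"
  proof (cases "u < 1")
    case True
    then have "\<mu> * ln (1 - u) \<le> \<mu> * (- u)"
      using \<mu> ln_le_minus_one[of "1 - u"] by (intro mult_left_mono) auto
    then show ?thesis using True mu by (simp add: powr_def)
  qed (simp add: max_def)
  \<comment> \<open>The constant 4 serves both cases. For u \<le> 1/2 the logarithm bound loses 2 k
    s^2 / D, and 2 k \<le> 4. For u > 1/2 one has D \<le> D^2 \<le> 4 s^2, so the left side is not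
    positive.\<close>
  have lower: "exp (- (k * s)) * (1 - 4 * s\<^sup>2 / D) \<le> max 0 (1 - u) powr \<mu>"
  proof (cases "u \<le> 1 / 2")
    case True
    have "\<mu> * (2 * u\<^sup>2) = 2 * k * s\<^sup>2 / D"
      using D by (simp add: u_def k_def power2_eq_square)
    also have "\<dots> \<le> 4 * s\<^sup>2 / D"
      using k D by (intro divide_right_mono mult_right_mono) auto
    finally have "1 - 4 * s\<^sup>2 / D \<le> 1 + (- (\<mu> * (2 * u\<^sup>2)))" by simp
    also have "\<dots> \<le> exp (- (\<mu> * (2 * u\<^sup>2)))" by (rule exp_ge_add_one_self)
    finally have "exp (- (k * s)) * (1 - 4 * s\<^sup>2 / D) \<le> exp (- (k * s)) * exp (- (\<mu> * (2 * u\<^sup>2)))"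
      by (intro mult_left_mono) auto
    also have "\<dots> = exp (\<mu> * (- u - 2 * u\<^sup>2))"
      unfolding exp_add[symmetric] mu[symmetric] by (simp add: algebra_simps)
    also have "\<dots> \<le> exp (\<mu> * ln (1 - u))"
      using \<mu> ln_one_minus_pos_lower_bound[OF u True] by (simp add: mult_left_mono)
    also have "\<dots> = max 0 (1 - u) powr \<mu>" using True by (simp add: powr_def)
    finally show ?thesis .
  next
    case False
    have "D < 2 * s" using False D by (simp add: u_def field_simps)
    then have "D * D \<le> (2 * s) * (2 * s)" using D by (intro mult_mono) auto
    moreover have "D * 1 \<le> D * D" using D by (intro mult_left_mono) auto
    ultimately have "D \<le> 4 * s\<^sup>2" unfolding power2_eq_square by linarith
    then have "1 \<le> 4 * s\<^sup>2 / D" using D by simp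
    then have "exp (- (k * s)) * (1 - 4 * s\<^sup>2 / D) \<le> 0"
      by (intro mult_nonneg_nonpos) auto
    then show ?thesis by (rule order_trans) simp
  qed
  have "\<bar>max 0 (1 - u) powr \<mu> - exp (- (k * s))\<bar> \<le> exp (- (k * s)) * (4 * s\<^sup>2 / D)"
    using upper lower by (simp add: right_diff_distrib)
  also have "\<dots> \<le> exp (- (3 / 4 * s)) * (4 * (32 * exp (s / 4)) / D)"
    using E q D by (intro mult_mono divide_right_mono mult_left_mono) auto
  also have "\<dots> = 128 / D * exp (- (s / 2))"
    unfolding Es[symmetric] by simp
  finally have 1: "\<bar>max 0 (1 - u) powr \<mu> - exp (- (k * s))\<bar> \<le> 128 / D * exp (- (s / 2))" .
  have "\<bar>exp (- (k * s)) - exp (- s)\<bar> \<le> \<bar>k * s - s\<bar> * exp (- (3 / 4 * s))"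
    using ks s by (intro abs_exp_minus_diff_le) auto
  also have "k * s - s = (k - 1) * s" by (simp add: left_diff_distrib)
  also have "\<bar>(k - 1) * s\<bar> = \<bar>k - 1\<bar> * s"
    by (simp only: abs_mult abs_of_nonneg[OF s])
  also have "\<bar>k - 1\<bar> * s * exp (- (3 / 4 * s)) \<le> \<bar>k - 1\<bar> * (4 * exp (s / 4)) * exp (- (3 / 4 * s))"
    using l s by (intro mult_mono) auto
  also have "\<dots> = 4 * \<bar>k - 1\<bar> * exp (- (s / 2))"
    unfolding Es[symmetric] by simp
  finally have 2: "\<bar>exp (- (k * s)) - exp (- s)\<bar> \<le> 4 * \<bar>k - 1\<bar> * exp (- (s / 2))" .
  have "\<bar>max 0 (1 - u) powr \<mu> - exp (- s)\<bar> \<le> 128 / D * exp (- (s / 2)) + 4 * \<bar>k - 1\<bar> * exp (- (s / 2))"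
    using 1 2 by linarith
  then show ?thesis by (simp add: u_def k_def distrib_right)
qed

text \<open>The factor \<open>D / \<mu>\<close> is what the Wendland normalization leaves over.
  Replacing it by 1 costs one more \<open>\<bar>D / \<mu> - 1\<bar>\<close>, hence 5 instead of
  4.\<close>

lemma abs_scaled_powr_minus_exp_le:
  fixes \<mu> D s :: real
  assumes \<mu>: "\<mu> > 0" and D: "D \<ge> 1" and a: "3 * D \<le> 4 * \<mu>" "4 * \<mu> \<le> 5 * D" and s: "s \<ge> 0"
  shows "\<bar>D / \<mu> * max 0 (1 - s / D) powr \<mu> - exp (- s)\<bar> \<le> (128 / \<mu> + 5 * \<bar>D / \<mu> - 1\<bar>) * exp (- (s / 2))"
proof -
  let ?g = "max 0 (1 - s / D) powr \<mu>"
  have c: "D / \<mu> > 0" using \<mu> D by simp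
  have "\<bar>D / \<mu> * (?g - exp (- s))\<bar> = D / \<mu> * \<bar>?g - exp (- s)\<bar>"
    by (simp only: abs_mult abs_of_pos[OF c])
  also have "\<dots> \<le> D / \<mu> * ((128 / D + 4 * \<bar>\<mu> / D - 1\<bar>) * exp (- (s / 2)))"
    by (rule mult_left_mono[OF abs_powr_minus_exp_le[OF assms] less_imp_le[OF c]])
  also have "\<dots> = (D / \<mu> * (128 / D) + 4 * (D / \<mu> * \<bar>\<mu> / D - 1\<bar>)) * exp (- (s / 2))"
    by (simp add: algebra_simps)
  also have "D / \<mu> * (128 / D) = 128 / \<mu>" using D by simp
  also have "D / \<mu> * \<bar>\<mu> / D - 1\<bar> = \<bar>D / \<mu> * (\<mu> / D - 1)\<bar>"
    by (simp only: abs_mult abs_of_pos[OF c])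
  also have "D / \<mu> * (\<mu> / D - 1) = 1 - D / \<mu>"
    using \<mu> D by (simp add: right_diff_distrib)
  finally have 1: "\<bar>D / \<mu> * (?g - exp (- s))\<bar> \<le> (128 / \<mu> + 4 * \<bar>1 - D / \<mu>\<bar>) * exp (- (s / 2))" .
  have 2: "\<bar>(D / \<mu> - 1) * exp (- s)\<bar> \<le> \<bar>D / \<mu> - 1\<bar> * exp (- (s / 2))"
    unfolding abs_mult using s by (intro mult_left_mono) auto
  have "D / \<mu> * ?g - exp (- s) = D / \<mu> * (?g - exp (- s)) + (D / \<mu> - 1) * exp (- s)"
    by (simp only: left_diff_distrib right_diff_distrib)
  then have "\<bar>D / \<mu> * ?g - exp (- s)\<bar> \<le>
      (128 / \<mu> + 4 * \<bar>1 - D / \<mu>\<bar>) * exp (- (s / 2)) + \<bar>D / \<mu> - 1\<bar> * exp (- (s / 2))"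
    using 1 2 by linarith
  then show ?thesis by (simp add: distrib_right abs_minus_commute)
qed

section \<open>Growth of the reparameterized support and the resulting normalization\<close>

lemma Gamma_ratio_bounds:
  fixes x p :: real
  assumes x: "x > 1" and p: "p > 0"
  shows "(x - 1) powr p \<le> Gamma (x + p) / Gamma x" "Gamma (x + p) / Gamma x \<le> (x + p) powr p"
proof -
  let ?f = "ln \<circ> Gamma :: real \<Rightarrow> real"
  have G: "Gamma y > 0" if "y > 0" for y :: real using that by (rule Gamma_real_pos)
  have step: "?f (y + 1) - ?f y = ln y" if "y > 0" for y
  proof -
    have "y \<notin> \<int>\<^sub>\<le>\<^sub>0" using that by (auto elim!: nonpos_Ints_cases)
    moreover have "Gamma y \<noteq> 0" using G[OF that] by (rule less_imp_neq[symmetric])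
    ultimately show ?thesis using that by (simp add: Gamma_plus1 ln_mult)
  qed
  have ratio: "Gamma (x + p) / Gamma x = exp (?f (x + p) - ?f x)"
    using x p G[of x] G[of "x + p"] by (simp add: exp_diff)
  \<comment> \<open>The slope of \<open>ln \<Gamma>\<close> over \<open>[x, x + p]\<close> lies between its slopes over \<open>[x - 1, x]\<close> and
    \<open>[x + p, x + p + 1]\<close>, which the functional equation evaluates.\<close>
  note slope = convex_on_slope_le[OF log_convex_Gamma_real]
  have "(?f (x - 1) - ?f x) / (x - 1 - x) \<le> (?f x - ?f (x + p)) / (x - (x + p))"
    using x p by (intro order_trans[OF slope(1)[of "x - 1" "x + p" x] slope(2)]) auto
  then have "ln (x - 1) \<le> (?f (x + p) - ?f x) / p"
    using step[of "x - 1"] x p by (simp add: field_simps)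
  then have "p * ln (x - 1) \<le> ?f (x + p) - ?f x"
    using p by (simp add: field_simps)
  then have "exp (p * ln (x - 1)) \<le> exp (?f (x + p) - ?f x)" by (simp only: exp_le_cancel_iff)
  then show "(x - 1) powr p \<le> Gamma (x + p) / Gamma x"
    unfolding ratio using x by (simp add: powr_def)
  have "(?f x - ?f (x + p)) / (x - (x + p)) \<le> (?f (x + p) - ?f (x + p + 1)) / (x + p - (x + p + 1))"
    using x p by (intro order_trans[OF slope(1)[of x "x + p + 1" "x + p"] slope(2)]) auto
  then have "(?f (x + p) - ?f x) / p \<le> ln (x + p)"
    using step[of "x + p"] x p by (simp add: field_simps)
  then have "?f (x + p) - ?f x \<le> p * ln (x + p)"
    using p by (simp add: field_simps)
  then have "exp (?f (x + p) - ?f x) \<le> exp (p * ln (x + p))" by (simp only: exp_le_cancel_iff)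
  then show "Gamma (x + p) / Gamma x \<le> (x + p) powr p"
    unfolding ratio using x p by (simp add: powr_def)
qed

text \<open>The p-th root of the Gamma ratio bounds with p = 1 + 2 \<nu>. It makes
  \<open>D / \<mu> - 1\<close> of order 1 / \<mu>.\<close>

lemma wendland_support_bounds:
  assumes \<nu>: "\<nu> \<ge> 0" and \<beta>: "\<beta> > 0" and \<mu>: "\<mu> > 1"
  shows "\<mu> - 1 \<le> wendland_support \<nu> \<mu> \<beta> / \<beta>" "wendland_support \<nu> \<mu> \<beta> / \<beta> \<le> \<mu> + 2 * \<nu> + 1"
proof -
  define p where "p = 1 + 2 * \<nu>"
  have p: "p > 0" using \<nu> by (simp add: p_def)
  have D: "wendland_support \<nu> \<mu> \<beta> / \<beta> = (Gamma (\<mu> + p) / Gamma \<mu>) powr (1 / p)"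
    using \<beta> by (simp add: wendland_support_def p_def algebra_simps)
  have "((\<mu> - 1) powr p) powr (1 / p) \<le> (Gamma (\<mu> + p) / Gamma \<mu>) powr (1 / p)"
    using Gamma_ratio_bounds(1)[OF \<mu> p] p by (intro powr_mono2) auto
  then show "\<mu> - 1 \<le> wendland_support \<nu> \<mu> \<beta> / \<beta>"
    unfolding D powr_powr using p \<mu> by simp
  have "(Gamma (\<mu> + p) / Gamma \<mu>) powr (1 / p) \<le> ((\<mu> + p) powr p) powr (1 / p)"
    using Gamma_ratio_bounds(2)[OF \<mu> p] p \<mu>
    by (intro powr_mono2) (auto intro!: divide_nonneg_pos Gamma_real_pos less_imp_le)
  then show "wendland_support \<nu> \<mu> \<beta> / \<beta> \<le> \<mu> + 2 * \<nu> + 1"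
    unfolding D powr_powr using p \<mu> by (simp add: p_def)
qed

text \<open>Here the choice of the support pays off. With \<open>R\<close> the Gamma ratio in its
  definition, D^(1 + 2 \<nu>) = R, so the substitution factor D^(- 2 \<nu>) is D / R; this
  \<open>R\<close> cancels against the one in
  \<open>Beta (2 * \<nu>) (\<mu> + 1) = Gamma (2 * \<nu>) * \<mu> / R\<close>.\<close>

lemma reparam_wendland_eq_integral:
  assumes \<nu>: "\<nu> > 0" and \<beta>: "\<beta> > 0" and \<mu>: "\<mu> > 0" and r: "r > 0"
  defines "x \<equiv> r / \<beta>" and "D \<equiv> wendland_support \<nu> \<mu> \<beta> / \<beta>"
  shows "reparam_wendland \<nu> \<mu> \<beta> r =
    D / \<mu> * (LBINT w:{0<..}. w powr (\<nu> - 1) * max 0 (1 - sqrt (w + x\<^sup>2) / D) powr \<mu>) / (2 * Gamma (2 * \<nu>))"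
proof -
  let ?I = "LBINT w:{0<..}. w powr (\<nu> - 1) * max 0 (1 - sqrt (w + x\<^sup>2) / D) powr \<mu>"
  define R where "R = Gamma (\<mu> + 2 * \<nu> + 1) / Gamma \<mu>"
  have G: "Gamma \<mu> > 0" "Gamma (\<mu> + 2 * \<nu> + 1) > 0" "Gamma (2 * \<nu>) > 0"
    using \<nu> \<mu> by (auto intro!: Gamma_real_pos)
  have R: "R > 0" using G by (simp add: R_def)
  have DR: "D = R powr (1 / (1 + 2 * \<nu>))" using \<beta> by (simp add: D_def R_def wendland_support_def)
  have D: "D > 0" using R by (simp add: DR)
  have x: "x > 0" unfolding x_def using r \<beta> by (rule divide_pos_pos)
  have b: "wendland_support \<nu> \<mu> \<beta> = \<beta> * D" using \<beta> by (simp add: D_def)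
  have rb: "r / (\<beta> * D) = x / D" by (simp add: x_def)
  have gt: "r > \<beta> * D \<longleftrightarrow> x > D" using \<beta> by (simp add: x_def field_simps)
  show ?thesis
  proof (cases "x > D")
    \<comment> \<open>Outside the support the truncated base is 0 for every w > 0, so the integral
      vanishes as well.\<close>
    case True
    have z: "max 0 (1 - sqrt (w + x\<^sup>2) / D) = 0" if "w > 0" for w
    proof -
      have "D\<^sup>2 \<le> x\<^sup>2" using True D by (intro power_mono) auto
      then have "sqrt (w + x\<^sup>2) \<ge> D" using that by (intro real_le_rsqrt) simp
      then show ?thesis using D by (simp add: max_def)
    qed
    have "?I = (LBINT w:{0::real<..}. (0::real))"
      by (rule set_lebesgue_integral_cong) (auto simp: z)
    then have "?I = 0" by simp
    then show ?thesis
      using True by (simp add: reparam_wendland_def gen_wendland_def b gt)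
  next
    case False
    have "D powr (1 + 2 * \<nu>) = R" unfolding DR powr_powr using \<nu> R by simp
    then have "D * D powr (2 * \<nu>) = R" using D by (simp add: powr_add)
    then have Dp: "D powr (- 2 * \<nu>) = D / R"
      using D R by (simp add: powr_minus field_simps)
    have \<mu>': "\<mu> \<notin> \<int>\<^sub>\<le>\<^sub>0" using \<mu> by (auto elim!: nonpos_Ints_cases)
    have "2 * \<nu> + (\<mu> + 1) = \<mu> + 2 * \<nu> + 1" by simp
    then have B: "Beta (2 * \<nu>) (\<mu> + 1) = Gamma (2 * \<nu>) * \<mu> / R"
      unfolding Beta_def R_def by (simp only: Gamma_plus1[OF \<mu>']) (simp add: mult.assoc)
    have "reparam_wendland \<nu> \<mu> \<beta> r = 1 / Beta (2 * \<nu>) (\<mu> + 1) * (D powr (- 2 * \<nu>) / 2 * ?I)"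
      using False \<nu> unfolding wendland_integral_substitution[OF D x, symmetric]
      by (simp add: reparam_wendland_def gen_wendland_def b gt rb)
    also have "\<dots> = D / \<mu> * ?I / (2 * Gamma (2 * \<nu>))"
      unfolding B Dp using R G \<mu> by (simp add: field_simps)
    finally show ?thesis .
  qed
qed

section \<open>Integrated error bound and uniform convergence\<close>

text \<open>This weight is the majorant free of \<open>x\<close>. Substituting w = 4 t^2 gives
  Euler's integral for \<open>Gamma (2 * \<nu>)\<close>, so the normalization by
  \<open>2 * Gamma (2 * \<nu>)\<close> later leaves just \<open>4 powr \<nu>\<close>.\<close>

lemma exp_half_sqrt_weight_integral:
  assumes \<nu>: "\<nu> > 0"
  shows "set_integrable lborel {0<..} (\<lambda>w. w powr (\<nu> - 1) * exp (- (sqrt w / 2)))"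
    and "(LBINT w:{0<..}. w powr (\<nu> - 1) * exp (- (sqrt w / 2))) = 2 * 4 powr \<nu> * Gamma (2 * \<nu>)"
proof -
  let ?f = "\<lambda>w. w powr (\<nu> - 1) * exp (- (sqrt w / 2))"
  let ?g = "\<lambda>t::real. 4 * t\<^sup>2"
  have img: "?g ` {0<..} = {0<..}"
  proof (intro equalityI subsetI)
    fix w :: real assume "w \<in> {0<..}"
    then have "w = ?g (sqrt w / 2)" "sqrt w / 2 \<in> {0<..}" by (auto simp: power_divide)
    then show "w \<in> ?g ` {0<..}" by (rule image_eqI)
  qed auto
  have inj: "inj_on ?g {0<..}" by (rule inj_onI) (simp add: power2_eq_iff_nonneg)
  have G: "Gamma (2 * \<nu>) > 0" using \<nu> by (auto intro!: Gamma_real_pos)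
  have "(\<integral>\<^sup>+w\<in>{0<..}. ennreal (?f w) \<partial>lborel) = (\<integral>\<^sup>+t\<in>{0<..}. ennreal (\<bar>8 * t\<bar> * ?f (?g t)) \<partial>lborel)"
    by (rule set_nn_integral_substitution[OF _ img _ _ inj]) (auto intro!: derivative_eq_intros)
  also have "\<dots> = (\<integral>\<^sup>+t. ennreal (2 * 4 powr \<nu>) *
      (ennreal (t powr (2 * \<nu> - 1) * exp (- t / 1)) * indicator {0<..} t) \<partial>lborel)"
  proof (intro nn_integral_cong)
    fix t :: real
    show "ennreal (\<bar>8 * t\<bar> * ?f (?g t)) * indicator {0<..} t = ennreal (2 * 4 powr \<nu>) *
      (ennreal (t powr (2 * \<nu> - 1) * exp (- t / 1)) * indicator {0<..} t)"
    proof (cases "t > 0")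
      case True
      have "(?g t) powr (\<nu> - 1) = 4 powr (\<nu> - 1) * (t\<^sup>2) powr (\<nu> - 1)"
        by (rule powr_mult)
      also have "(t\<^sup>2) powr (\<nu> - 1) = t powr (2 * \<nu> - 1) / t"
        using True powr_powr[of t 2 "\<nu> - 1"] by (simp add: powr_diff algebra_simps power2_eq_square)
      also have "(4::real) powr (\<nu> - 1) = 4 powr \<nu> / 4" by (simp add: powr_diff)
      finally have p: "(?g t) powr (\<nu> - 1) = 4 powr \<nu> / 4 * (t powr (2 * \<nu> - 1) / t)" .
      have sq: "sqrt (?g t) / 2 = t" using True by (simp add: real_sqrt_mult)
      have "\<bar>8 * t\<bar> * ?f (?g t) = 2 * 4 powr \<nu> * (t powr (2 * \<nu> - 1) * exp (- t / 1))"
        unfolding p sq using True by simp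
      then show ?thesis
        using True by (simp add: ennreal_mult'[symmetric] del: abs_mult)
    qed simp
  qed
  also have "\<dots> = ennreal (2 * 4 powr \<nu>) * ennreal (Gamma (2 * \<nu>) * 1 powr (2 * \<nu>))"
    by (subst nn_integral_cmult, simp, subst Gamma_eq_nn_integral_scaled) (use \<nu> in auto)
  also have "\<dots> = ennreal (2 * 4 powr \<nu> * Gamma (2 * \<nu>))"
    by (subst ennreal_mult'[symmetric]) auto
  finally have N: "(\<integral>\<^sup>+w\<in>{0<..}. ennreal (?f w) \<partial>lborel) = ennreal (2 * 4 powr \<nu> * Gamma (2 * \<nu>))" .
  show "set_integrable lborel {0<..} ?f"
    by (subst set_nn_integral_eq_integral(1)) (auto simp: N)
  have "(LBINT w:{0<..}. ?f w) = enn2real (\<integral>\<^sup>+w\<in>{0<..}. ennreal (?f w) \<partial>lborel)"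
    by (rule set_nn_integral_eq_integral(2)) auto
  then show "(LBINT w:{0<..}. ?f w) = 2 * 4 powr \<nu> * Gamma (2 * \<nu>)"
    unfolding N using G by simp
qed

text \<open>Uniformity in \<open>x\<close> originates here: sqrt (w + x^2) \<ge> sqrt w bounds every
  error by the fixed weight. The bound on \<open>k\<close>, together with \<open>diff\<close>, makes
  both integrals exist, so that they may be subtracted.\<close>

lemma abs_weighted_integral_diff_le:
  fixes h k :: "real \<Rightarrow> real"
  assumes \<nu>: "\<nu> > 0" and [measurable]: "h \<in> borel_measurable borel" "k \<in> borel_measurable borel"
    and diff: "\<And>s. s \<ge> 0 \<Longrightarrow> \<bar>h s - k s\<bar> \<le> e * exp (- (s / 2))"
    and k: "\<And>s. s \<ge> 0 \<Longrightarrow> \<bar>k s\<bar> \<le> exp (- (s / 2))"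
  shows "\<bar>(LBINT w:{0<..}. w powr (\<nu> - 1) * h (sqrt (w + x\<^sup>2))) -
      (LBINT w:{0<..}. w powr (\<nu> - 1) * k (sqrt (w + x\<^sup>2)))\<bar> \<le> e * (2 * 4 powr \<nu> * Gamma (2 * \<nu>))"
proof -
  let ?W = "\<lambda>w. w powr (\<nu> - 1) * exp (- (sqrt w / 2))"
  let ?H = "\<lambda>h w. w powr (\<nu> - 1) * h (sqrt (w + x\<^sup>2))"
  have e: "e \<ge> 0" using diff[of 0] by simp
  have dom: "\<bar>?H j w\<bar> \<le> d * ?W w"
    if j: "\<And>s. s \<ge> 0 \<Longrightarrow> \<bar>j s\<bar> \<le> d * exp (- (s / 2))" and "d \<ge> 0" "w > 0" for j d w
  proof -
    have "\<bar>j (sqrt (w + x\<^sup>2))\<bar> \<le> d * exp (- (sqrt (w + x\<^sup>2) / 2))"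
      using that by (intro j) auto
    also have "\<dots> \<le> d * exp (- (sqrt w / 2))"
      using that by (intro mult_left_mono) auto
    finally have "w powr (\<nu> - 1) * \<bar>j (sqrt (w + x\<^sup>2))\<bar> \<le> w powr (\<nu> - 1) * (d * exp (- (sqrt w / 2)))"
      by (intro mult_left_mono) auto
    then show ?thesis by (simp add: abs_mult mult_ac)
  qed
  have int: "set_integrable lborel {0<..} (?H j)"
    if j: "\<And>s. s \<ge> 0 \<Longrightarrow> \<bar>j s\<bar> \<le> d * exp (- (s / 2))" and "d \<ge> 0"
      and [measurable]: "j \<in> borel_measurable borel" for j d
  proof (rule set_integrable_bound[of _ _ "\<lambda>w. d * ?W w"])
    show "set_integrable lborel {0<..} (\<lambda>w. d * ?W w)"
      by (intro set_integrable_mult_right exp_half_sqrt_weight_integral \<nu>)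
    show "set_borel_measurable lborel {0<..} (?H j)"
      unfolding set_borel_measurable_def by measurable
    show "AE w in lborel. w \<in> {0<..} \<longrightarrow> norm (?H j w) \<le> norm (d * ?W w)"
      using dom[OF j \<open>d \<ge> 0\<close>] \<open>d \<ge> 0\<close> by (auto simp: abs_of_nonneg)
  qed
  have h: "\<bar>h s\<bar> \<le> (e + 1) * exp (- (s / 2))" if "s \<ge> 0" for s
    using diff[OF that] k[OF that] by (simp add: distrib_right)
  have ih: "set_integrable lborel {0<..} (?H h)" using h e by (intro int[of h "e + 1"]) auto
  have ik: "set_integrable lborel {0<..} (?H k)" using k by (intro int[of k 1]) auto
  have "\<bar>(LBINT w:{0<..}. ?H h w) - (LBINT w:{0<..}. ?H k w)\<bar> = norm (LBINT w:{0<..}. ?H h w - ?H k w)"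
    using ih ik by simp
  also have "\<dots> \<le> (LBINT w:{0<..}. \<bar>?H h w - ?H k w\<bar>)"
    using set_integral_norm_bound[OF set_integral_diff(1)[OF ih ik]] by simp
  also have "\<dots> \<le> (LBINT w:{0<..}. e * ?W w)"
  proof (rule set_integral_mono)
    show "set_integrable lborel {0<..} (\<lambda>w. \<bar>?H h w - ?H k w\<bar>)"
      by (intro set_integrable_abs set_integral_diff ih ik)
    show "set_integrable lborel {0<..} (\<lambda>w. e * ?W w)"
      by (intro set_integrable_mult_right exp_half_sqrt_weight_integral \<nu>)
    show "\<bar>?H h w - ?H k w\<bar> \<le> e * ?W w" if "w \<in> {0<..}" for w
      using dom[of "\<lambda>s. h s - k s" e w] diff e that by (simp add: right_diff_distrib)
  qed
  also have "\<dots> = e * (2 * 4 powr \<nu> * Gamma (2 * \<nu>))"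
    using exp_half_sqrt_weight_integral(2)[OF \<nu>] by simp
  finally show ?thesis .
qed

text \<open>The pointwise error factor is 128 / \<mu> + 5 \<bar>D / \<mu> - 1\<bar> with \<bar>D -
  \<mu>\<bar> \<le> 2 \<nu> + 1, whence 128 + 5 (2 \<nu> + 1) = 133 + 10 \<nu>; integration
  contributes \<open>4 powr \<nu>\<close>.\<close>

lemma reparam_wendland_matern_diff_le:
  assumes \<nu>: "\<nu> \<ge> 0" and \<beta>: "\<beta> > 0" and \<mu>: "\<mu> \<ge> 5 * (2 * \<nu> + 1)" and r: "r > 0"
  shows "\<bar>reparam_wendland \<nu> \<mu> \<beta> r - matern (\<nu> + 1 / 2) \<beta> r\<bar> \<le> 4 powr \<nu> * (133 + 10 * \<nu>) / \<mu>"
proof -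
  define D where "D = wendland_support \<nu> \<mu> \<beta> / \<beta>"
  define x where "x = r / \<beta>"
  define e where "e = 128 / \<mu> + 5 * \<bar>D / \<mu> - 1\<bar>"
  have \<mu>1: "\<mu> > 1" and \<mu>0: "\<mu> > 0" using \<nu> \<mu> by auto
  have Db: "\<mu> - 1 \<le> D" "D \<le> \<mu> + 2 * \<nu> + 1"
    unfolding D_def by (rule wendland_support_bounds[OF \<nu> \<beta> \<mu>1])+
  \<comment> \<open>The assumption on \<mu> gives 2 \<nu> + 1 \<le> \<mu> / 5 and \<mu> \<ge> 5, so
    D \<le> 6 \<mu> / 5 and D \<ge> \<mu> - 1 \<ge> 4 \<mu> / 5. This is the window required for
    \<open>D / \<mu>\<close>.\<close>
  have bound: "\<bar>D / \<mu> * max 0 (1 - s / D) powr \<mu> - exp (- s)\<bar> \<le> e * exp (- (s / 2))" if "s \<ge> 0" for s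
    unfolding e_def using \<mu>0 Db \<mu> \<nu> that by (intro abs_scaled_powr_minus_exp_le) auto
  have x: "x > 0" using r \<beta> by (simp add: x_def)
  have "\<bar>D / \<mu> - 1\<bar> = \<bar>D - \<mu>\<bar> / \<mu>"
    using \<mu>0 by (simp add: abs_if field_simps)
  also have "\<dots> \<le> (2 * \<nu> + 1) / \<mu>"
    using Db \<nu> \<mu>0 by (intro divide_right_mono) auto
  finally have "e \<le> (133 + 10 * \<nu>) / \<mu>"
    unfolding e_def by (simp add: add_divide_distrib)
  then have e: "4 powr \<nu> * e \<le> 4 powr \<nu> * (133 + 10 * \<nu>) / \<mu>"
    using mult_left_mono[of e "(133 + 10 * \<nu>) / \<mu>" "4 powr \<nu>"] by simp
  have "\<bar>reparam_wendland \<nu> \<mu> \<beta> r - matern (\<nu> + 1 / 2) \<beta> r\<bar> \<le> 4 powr \<nu> * e"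
  proof (cases "\<nu> = 0")
    \<comment> \<open>For \<nu> = 0 the Gamma ratio is \<mu> itself, so D = \<mu>, and the pointwise
      bound at s = x is already the claim.\<close>
    case True
    have "Gamma \<mu> \<noteq> 0" using Gamma_real_pos[OF \<mu>0] by (rule less_imp_neq[symmetric])
    moreover have "\<mu> \<notin> \<int>\<^sub>\<le>\<^sub>0" using \<mu>0 by (auto elim!: nonpos_Ints_cases)
    ultimately have "D = \<mu>"
      using True \<beta> \<mu>0 unfolding D_def wendland_support_def
      by (simp add: Gamma_plus1)
    then have "wendland_support 0 \<mu> \<beta> = \<beta> * \<mu>"
      using True \<beta> by (simp add: D_def field_simps)
    then have "reparam_wendland \<nu> \<mu> \<beta> r = max 0 (1 - x / D) powr \<mu>"
      using True \<beta> \<mu>0 \<open>D = \<mu>\<close>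
      by (auto simp: reparam_wendland_def gen_wendland_def x_def max_def field_simps)
    then show ?thesis
      using bound[of x] x True \<beta> r \<mu>0 \<open>D = \<mu>\<close> matern_half[OF \<beta> r]
      by (auto intro: order_trans[OF _ mult_left_le] simp: x_def e_def)
  next
    case False
    then have \<nu>0: "\<nu> > 0" using \<nu> by simp
    have G: "Gamma (2 * \<nu>) > 0" using \<nu>0 by (auto intro!: Gamma_real_pos)
    let ?h = "\<lambda>s. D / \<mu> * max 0 (1 - s / D) powr \<mu>"
    let ?H = "LBINT w:{0<..}. w powr (\<nu> - 1) * ?h (sqrt (w + x\<^sup>2))"
    let ?K = "LBINT w:{0<..}. w powr (\<nu> - 1) * exp (- sqrt (w + x\<^sup>2))"
    have "?H = (LBINT w:{0<..}. D / \<mu> * (w powr (\<nu> - 1) * max 0 (1 - sqrt (w + x\<^sup>2) / D) powr \<mu>))"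
      by (rule set_lebesgue_integral_cong) auto
    then have H: "?H = D / \<mu> * (LBINT w:{0<..}. w powr (\<nu> - 1) * max 0 (1 - sqrt (w + x\<^sup>2) / D) powr \<mu>)"
      by simp
    then have 1: "reparam_wendland \<nu> \<mu> \<beta> r = ?H / (2 * Gamma (2 * \<nu>))"
      unfolding H by (simp only: reparam_wendland_eq_integral[OF \<nu>0 \<beta> \<mu>0 r] x_def D_def)
    have 2: "matern (\<nu> + 1 / 2) \<beta> r = ?K / (2 * Gamma (2 * \<nu>))"
      using matern_eq_integral_exp_sqrt[OF \<nu>0 \<beta> r] by (simp add: x_def)
    have "\<bar>?H - ?K\<bar> \<le> e * (2 * 4 powr \<nu> * Gamma (2 * \<nu>))"
      by (rule abs_weighted_integral_diff_le[OF \<nu>0, where h = ?h and k = "\<lambda>s. exp (- s)"])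
         (use bound in auto)
    then have "\<bar>?H - ?K\<bar> / (2 * Gamma (2 * \<nu>)) \<le> 4 powr \<nu> * e"
      using G by (simp add: field_simps)
    then show ?thesis
      unfolding 1 2 diff_divide_distrib[symmetric] abs_divide using G by simp
  qed
  then show ?thesis using e by linarith
qed

theorem theorem3:
  fixes \<nu> \<beta> :: real
  assumes "\<nu> \<ge> 0" and "\<beta> > 0"
  shows "uniform_limit {0<..} (\<lambda>\<mu> r. reparam_wendland \<nu> \<mu> \<beta> r) (matern (\<nu> + 1/2) \<beta>) at_top \<and>
         ((\<lambda>\<mu>. SUP r\<in>{0<..}. \<bar>reparam_wendland \<nu> \<mu> \<beta> r - matern (\<nu> + 1/2) \<beta> r\<bar>) \<longlongrightarrow> 0) at_top"
proof -
  let ?d = "\<lambda>\<mu> r. \<bar>reparam_wendland \<nu> \<mu> \<beta> r - matern (\<nu> + 1/2) \<beta> r\<bar>"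
  let ?C = "4 powr \<nu> * (133 + 10 * \<nu>)"
  have bound: "\<forall>\<^sub>F \<mu> in at_top. \<forall>r\<in>{0<..}. ?d \<mu> r \<le> ?C / \<mu>"
    using eventually_ge_at_top[of "5 * (2 * \<nu> + 1)"]
    by eventually_elim (use reparam_wendland_matern_diff_le[OF assms] in auto)
  have lim: "((\<lambda>\<mu>. ?C / \<mu>) \<longlongrightarrow> 0) at_top"
    by (intro tendsto_divide_0[OF tendsto_const] filterlim_at_top_imp_at_infinity filterlim_ident)
  have "uniform_limit {0<..} (\<lambda>\<mu> r. reparam_wendland \<nu> \<mu> \<beta> r) (matern (\<nu> + 1/2) \<beta>) at_top"
    unfolding uniform_limit_iff
  proof (intro allI impI)
    fix \<epsilon> :: real assume "\<epsilon> > 0"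
    then have "\<forall>\<^sub>F \<mu> in at_top. ?C / \<mu> < \<epsilon>" using order_tendstoD(2)[OF lim] by blast
    with bound show "\<forall>\<^sub>F \<mu> in at_top. \<forall>r\<in>{0<..}. dist (reparam_wendland \<nu> \<mu> \<beta> r) (matern (\<nu> + 1/2) \<beta> r) < \<epsilon>"
      by eventually_elim (force simp: dist_real_def)
  qed
  moreover have "((\<lambda>\<mu>. SUP r\<in>{0<..}. ?d \<mu> r) \<longlongrightarrow> 0) at_top"
  proof (rule tendsto_sandwich[OF _ _ tendsto_const lim])
    \<comment> \<open>A real supremum dominates its terms only over a set that is bounded above, so
      even nonnegativity draws on \<open>bound\<close>. The sample point r = 1 is arbitrary.\<close>
    show "\<forall>\<^sub>F \<mu> in at_top. 0 \<le> (SUP r\<in>{0<..}. ?d \<mu> r)"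
      using bound
    proof eventually_elim
      case (elim \<mu>)
      then have "bdd_above (?d \<mu> ` {0<..})" by (auto intro!: bdd_aboveI2)
      then have "?d \<mu> 1 \<le> (SUP r\<in>{0<..}. ?d \<mu> r)" by (intro cSUP_upper) auto
      then show ?case by (rule order_trans[OF abs_ge_zero])
    qed
    show "\<forall>\<^sub>F \<mu> in at_top. (SUP r\<in>{0<..}. ?d \<mu> r) \<le> ?C / \<mu>"
      using bound by eventually_elim (auto intro!: cSUP_least)
  qed
  ultimately show ?thesis by blast
qed

end
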